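(* Let $\mathcal{A}\otimes\mathcal{C}$, $\epsilon$, the elements $O_A$, $O_{A_1,\dots,A_r}$ and the supercommutator $\llbracket\cdot,\cdot\rrbracket_+$ be as defined in the context. Let $A$ and $B$ be two lists of $\{1,\dots,N\}$. Then $$\llbracket O_A,O_B\rrbracket_+=\epsilon\,O_{A,B}+(e_{A\cap B})^2\,\llbracket O_{A,(A\cap B)},O_{(A\cap B),B}\rrbracket_+ +(e_{A\cap B})^2\,\llbracket O_{A\cap B},O_{(A\cap B),A,B}\rrbracket_+ .$$
   Context: Let $\mathbb{K}$ be $\mathbb{R}$ or $\mathbb{C}$ and $N\ge1$. $\mathcal{A}$ is the unital associative $\mathbb{K}$-algebra generated by $x_1,\dots,x_N,p_1,\dots,p_N$ subject to the relations, for all $i,j$, $$[x_i,x_j]=0,\quad [p_i,p_j]=0,\quad \Big[\tfrac12\sum_{i=1}^N p_i^2,\,x_j\Big]=p_j,\quad \Big[\tfrac12\sum_{i=1}^N x_i^2,\,p_j\Big]=-x_j,$$ where $[a,b]=ab-ba$. Fix $\epsilon\in\{+1,-1\}$. $\mathcal{C}$ is the Clifford algebra over $\mathbb{K}$ generated by $e_1,\dots,e_N$ with $e_ie_j+e_je_i=2\epsilon\delta_{ij}$. In $\mathcal{A}\otimes\mathcal{C}$ the tensor sign is omitted, and the $e_i$ commute with all $x_j,p_j$. Put $\underline{D}=\sum_{i=1}^N e_ip_i$. A list is a finite (possibly empty) sequence $A=a_1\cdots a_n$ of distinct elements of $\{1,\dots,N\}$, $|A|=n$; $e_A=e_{a_1}\cdots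 e_{a_n}$, $e_\emptyset=1$. In set operations a list is viewed as its underlying set; $A\triangle B=(A\cup B)\setminus(A\cap B)$ is the symmetric difference. When used as a list, $A\cap B$ denotes the common elements of $A$ and $B$ in the order in which they occur in $A$. The square $(e_{A\cap B})^2$ is a scalar $\pm1$. For a set (or list) $S\subset\{1,\dots,N\}$, $\underline{x}_S=\sum_{s\in S}x_se_s$. For lists $A_1,\dots,A_r$ ($r\ge1$), with $S=A_1\triangle\cdots\triangle A_r$ and $E=e_{A_1}\cdots e_{A_r}$, define $$O_{A_1,\dots,A_r}=\tfrac12\big(\underline{D}\,\underline{x}_S E-E\,\underline{x}_S\underline{D}-\epsilon E\big);$$ in particular $O_A$ is the case $r=1$. The set $S$ is called the index set of $O_{A_1,\dots,A_r}$. For two such operators $X,Y$ with index sets $S,T$, the supercommutators are $$\llbracket X,Y\rrbracket_\mp=XY\mp(-1)^{|S||T|-|S\cap T|}YX .$$ *)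

theory Defs
  imports Complex_Main "HOL-Library.Poly_Mapping"
begin

section \<open>The ground field and the sign\<close>

text \<open>A field of this class is isomorphic to the reals or to the complex numbers.\<close>

class real_or_complex = field_char_0 +
  assumes real_or_complex:
    "\<exists>f :: 'a \<Rightarrow> complex. inj f \<and> (\<forall>a b. f (a + b) = f a + f b) \<and> (\<forall>a b. f (a * b) = f a * f b)
       \<and> (range f = \<real> \<or> range f = UNIV)"

instance real :: real_or_complex
proof
  show "\<exists>f :: real \<Rightarrow> complex. inj f \<and> (\<forall>a b. f (a + b) = f a + f b) \<and> (\<forall>a b. f (a * b) = f a * f b)
       \<and> (range f = \<real> \<or> range f = UNIV)"
    by (rule exI[of _ complex_of_real]) (auto simp: inj_def Reals_def)
qed

instance complex :: real_or_complex
proof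
  show "\<exists>f :: complex \<Rightarrow> complex. inj f \<and> (\<forall>a b. f (a + b) = f a + f b) \<and> (\<forall>a b. f (a * b) = f a * f b)
       \<and> (range f = \<real> \<or> range f = UNIV)"
    by (rule exI[of _ "\<lambda>z. z"]) auto
qed

text \<open>
  The Clifford algebra depends on the sign \<open>\<epsilon>\<close>. As a type cannot depend on a term, the sign is
  carried by a type parameter of the following class; both values occur.
\<close>

class sign =
  fixes sign_val :: "'a itself \<Rightarrow> int"
  assumes sign_val: "sign_val TYPE('a) \<in> {1, -1}"

datatype pos_sign = Pos_Sign
datatype neg_sign = Neg_Sign

instantiation pos_sign :: sign
begin
definition "sign_val (_ :: pos_sign itself) = (1 :: int)"
instance by standard (simp add: sign_val_pos_sign_def)
end

instantiation neg_sign :: sign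
begin
definition "sign_val (_ :: neg_sign itself) = (-1 :: int)"
instance by standard (simp add: sign_val_neg_sign_def)
end


section \<open>Algebras given by generators and relations\<close>

text \<open>
  Words under concatenation form the free monoid (written additively, as required by the
  convolution product on finitely supported functions), so \<open>'g word \<Rightarrow>\<^sub>0 'k\<close> is the free unital
  associative \<open>'k\<close>-algebra on \<open>'g\<close>.
\<close>

datatype 'g word = Word "'g list"

instantiation word :: (type) monoid_add
begin

definition "0 = Word []"

fun plus_word :: "'a word \<Rightarrow> 'a word \<Rightarrow> 'a word" where
  "Word u + Word v = Word (u @ v)"

instance
proof
  fix a b c :: "'a word"
  show "a + b + c = a + (b + c)" by (cases a; cases b; cases c) simp
  show "0 + a = a" "a + 0 = a" by (cases a; simp add: zero_word_def)+
qed

end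

definition gen :: "'g \<Rightarrow> ('g word \<Rightarrow>\<^sub>0 'k::field)" where
  "gen g = Poly_Mapping.single (Word [g]) 1"

definition scal :: "'k \<Rightarrow> ('m::monoid_add \<Rightarrow>\<^sub>0 'k::field)" where
  "scal c = Poly_Mapping.single 0 c"

definition commutator :: "'a::ring \<Rightarrow> 'a \<Rightarrow> 'a" where
  "commutator a b = a * b - b * a"

inductive_set ideal_gen :: "'a::ring_1 set \<Rightarrow> 'a set" for R where
  zero: "0 \<in> ideal_gen R"
| gen: "r \<in> R \<Longrightarrow> a * r * b \<in> ideal_gen R"
| add: "x \<in> ideal_gen R \<Longrightarrow> y \<in> ideal_gen R \<Longrightarrow> x + y \<in> ideal_gen R"

definition cong_mod :: "'a::ring_1 set \<Rightarrow> 'a \<Rightarrow> 'a \<Rightarrow> bool" where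
  "cong_mod R a b \<longleftrightarrow> a - b \<in> ideal_gen R"

lemma ideal_gen_mult_left: "x \<in> ideal_gen R \<Longrightarrow> c * x \<in> ideal_gen R"
proof (induction rule: ideal_gen.induct)
  case (gen r a b)
  then show ?case using ideal_gen.gen[of r R "c * a" b] by (simp add: mult.assoc)
qed (auto simp: distrib_left intro: ideal_gen.intros)

lemma ideal_gen_mult_right: "x \<in> ideal_gen R \<Longrightarrow> x * c \<in> ideal_gen R"
proof (induction rule: ideal_gen.induct)
  case (gen r a b)
  then show ?case using ideal_gen.gen[of r R a "b * c"] by (simp add: mult.assoc)
qed (auto simp: distrib_right intro: ideal_gen.intros)

lemma ideal_gen_uminus: "x \<in> ideal_gen R \<Longrightarrow> - x \<in> ideal_gen R"
  using ideal_gen_mult_left[of x R "- 1"] by simp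

lemma cong_mod_add: "cong_mod R a b \<Longrightarrow> cong_mod R c d \<Longrightarrow> cong_mod R (a + c) (b + d)"
  unfolding cong_mod_def using ideal_gen.add[of "a - b" R "c - d"] by (simp add: algebra_simps)

lemma cong_mod_uminus: "cong_mod R a b \<Longrightarrow> cong_mod R (- a) (- b)"
  unfolding cong_mod_def using ideal_gen_uminus[of "a - b" R] by (simp add: algebra_simps)

lemma cong_mod_diff: "cong_mod R a b \<Longrightarrow> cong_mod R c d \<Longrightarrow> cong_mod R (a - c) (b - d)"
  using cong_mod_add[of R a b "- c" "- d"] cong_mod_uminus[of R c d] by simp

lemma cong_mod_mult: "cong_mod R a b \<Longrightarrow> cong_mod R c d \<Longrightarrow> cong_mod R (a * c) (b * d)"
  unfolding cong_mod_def
  using ideal_gen.add[OF ideal_gen_mult_right[of "a - b" R c] ideal_gen_mult_left[of "c - d" R b]]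
  by (simp add: algebra_simps)

lemma cong_mod_refl: "cong_mod R a a"
  by (simp add: cong_mod_def ideal_gen.zero)

lemma equivp_cong_mod: "equivp (cong_mod R)"
proof (rule equivpI)
  show "reflp (cong_mod R)" by (simp add: reflp_def cong_mod_refl)
  show "symp (cong_mod R)"
    unfolding symp_def cong_mod_def using ideal_gen_uminus by fastforce
  show "transp (cong_mod R)"
    unfolding transp_def cong_mod_def using ideal_gen.add by fastforce
qed


section \<open>The algebra \<open>\<A>\<close>\<close>

datatype 'n xp = X 'n | P 'n

definition A_rels :: "('n::finite xp word \<Rightarrow>\<^sub>0 'k::real_or_complex) set" where
  "A_rels =
     {commutator (gen (X i)) (gen (X j)) | i j. True} \<union>
     {commutator (gen (P i)) (gen (P j)) | i j. True} \<union>
     {commutator (scal (1/2) * (\<Sum>i\<in>UNIV. gen (P i) ^ 2)) (gen (X j)) - gen (P j) | j. True} \<union>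
     {commutator (scal (1/2) * (\<Sum>i\<in>UNIV. gen (X i) ^ 2)) (gen (P j)) + gen (X j) | j. True}"

quotient_type (overloaded) ('k, 'n) alg_A = "'n::finite xp word \<Rightarrow>\<^sub>0 'k::real_or_complex" / "cong_mod A_rels"
  by (rule equivp_cong_mod)

instantiation alg_A :: (real_or_complex, finite) "{ring, monoid_mult}"
begin

lift_definition zero_alg_A :: "('a, 'b) alg_A" is 0 .
lift_definition one_alg_A :: "('a, 'b) alg_A" is 1 .
lift_definition plus_alg_A :: "('a, 'b) alg_A \<Rightarrow> ('a, 'b) alg_A \<Rightarrow> ('a, 'b) alg_A" is "(+)"
  by (rule cong_mod_add)
lift_definition minus_alg_A :: "('a, 'b) alg_A \<Rightarrow> ('a, 'b) alg_A \<Rightarrow> ('a, 'b) alg_A" is "(-)"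
  by (rule cong_mod_diff)
lift_definition uminus_alg_A :: "('a, 'b) alg_A \<Rightarrow> ('a, 'b) alg_A" is uminus
  by (rule cong_mod_uminus)
lift_definition times_alg_A :: "('a, 'b) alg_A \<Rightarrow> ('a, 'b) alg_A \<Rightarrow> ('a, 'b) alg_A" is "(*)"
  by (rule cong_mod_mult)

instance
  by standard (transfer; simp add: algebra_simps cong_mod_refl)+

end

lift_definition scale_A :: "'k \<Rightarrow> ('k::real_or_complex, 'n::finite) alg_A \<Rightarrow> ('k, 'n) alg_A"
  is "\<lambda>c a. scal c * a"
  by (intro cong_mod_mult cong_mod_refl)

lift_definition x_A :: "'n \<Rightarrow> ('k::real_or_complex, 'n::finite) alg_A" is "\<lambda>i. gen (X i)" .
lift_definition p_A :: "'n \<Rightarrow> ('k::real_or_complex, 'n::finite) alg_A" is "\<lambda>i. gen (P i)" .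


section \<open>The Clifford algebra \<open>\<C>\<close>\<close>

definition C_rels :: "'s::sign itself \<Rightarrow> ('n word \<Rightarrow>\<^sub>0 'k::real_or_complex) set" where
  "C_rels s =
     {gen i * gen j + gen j * gen i - scal (2 * of_int (sign_val s) * (if i = j then 1 else 0)) | i j. True}"

quotient_type (overloaded) ('k, 'n, 's) clifford = "'n::finite word \<Rightarrow>\<^sub>0 'k::real_or_complex" /
    "cong_mod (C_rels TYPE('s::sign))"
  by (rule equivp_cong_mod)

instantiation clifford :: (real_or_complex, finite, sign) "{ring, monoid_mult}"
begin

lift_definition zero_clifford :: "('a, 'b, 'c) clifford" is 0 .
lift_definition one_clifford :: "('a, 'b, 'c) clifford" is 1 .
lift_definition plus_clifford :: "('a, 'b, 'c) clifford \<Rightarrow> ('a, 'b, 'c) clifford \<Rightarrow> ('a, 'b, 'c) clifford"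
  is "(+)" by (rule cong_mod_add)
lift_definition minus_clifford :: "('a, 'b, 'c) clifford \<Rightarrow> ('a, 'b, 'c) clifford \<Rightarrow> ('a, 'b, 'c) clifford"
  is "(-)" by (rule cong_mod_diff)
lift_definition uminus_clifford :: "('a, 'b, 'c) clifford \<Rightarrow> ('a, 'b, 'c) clifford"
  is uminus by (rule cong_mod_uminus)
lift_definition times_clifford :: "('a, 'b, 'c) clifford \<Rightarrow> ('a, 'b, 'c) clifford \<Rightarrow> ('a, 'b, 'c) clifford"
  is "(*)" by (rule cong_mod_mult)

instance
  by standard (transfer; simp add: algebra_simps cong_mod_refl)+

end

lift_definition scale_C :: "'k \<Rightarrow> ('k::real_or_complex, 'n::finite, 's::sign) clifford \<Rightarrow> ('k, 'n, 's) clifford"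
  is "\<lambda>c a. scal c * a"
  by (intro cong_mod_mult cong_mod_refl)

lift_definition e_C :: "'n \<Rightarrow> ('k::real_or_complex, 'n::finite, 's::sign) clifford" is gen .


section \<open>The tensor product \<open>\<A> \<otimes> \<C>\<close>\<close>

text \<open>
  Pairs form a monoid under componentwise multiplication (again written additively), so
  \<open>('a, 'c) pair \<Rightarrow>\<^sub>0 'k\<close> is the free \<open>'k\<close>-vector space on the set of pairs, with
  multiplication extending \<open>(a, c) (a', c') = (a a', c c')\<close> bilinearly. Multiplying a bilinearity
  relator by a pair gives a bilinearity relator again, so the ideal generated by these relators is
  their linear span, and the quotient is the usual tensor product of algebras.
\<close>

datatype ('a, 'c) pair = Pair 'a 'c

instantiation pair :: (monoid_mult, monoid_mult) monoid_add
begin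

definition "0 = Pair 1 1"

fun plus_pair :: "('a, 'b) pair \<Rightarrow> ('a, 'b) pair \<Rightarrow> ('a, 'b) pair" where
  "Pair a c + Pair a' c' = Pair (a * a') (c * c')"

instance
proof
  fix a b c :: "('a, 'b) pair"
  show "a + b + c = a + (b + c)" by (cases a; cases b; cases c) (simp add: mult.assoc)
  show "0 + a = a" "a + 0 = a" by (cases a; simp add: zero_pair_def)+
qed

end

definition pure :: "'a \<Rightarrow> 'c \<Rightarrow> (('a, 'c) pair \<Rightarrow>\<^sub>0 'k::field)" where
  "pure a c = Poly_Mapping.single (Pair a c) 1"

definition tensor_rels ::
  "('k \<Rightarrow> 'a \<Rightarrow> 'a) \<Rightarrow> ('k \<Rightarrow> 'c \<Rightarrow> 'c) \<Rightarrow>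
     (('a::{ring, monoid_mult}, 'c::{ring, monoid_mult}) pair \<Rightarrow>\<^sub>0 'k::field) set" where
  "tensor_rels scaleA scaleC =
     {pure (a + a') c - pure a c - pure a' c | a a' c. True} \<union>
     {pure a (c + c') - pure a c - pure a c' | a c c'. True} \<union>
     {pure (scaleA k a) c - scal k * pure a c | k a c. True} \<union>
     {pure a (scaleC k c) - scal k * pure a c | k a c. True}"

quotient_type (overloaded) ('k, 'n, 's) alg_AC =
    "(('k::real_or_complex, 'n::finite) alg_A, ('k, 'n, 's::sign) clifford) pair \<Rightarrow>\<^sub>0 'k" /
    "cong_mod (tensor_rels scale_A scale_C)"
  by (rule equivp_cong_mod)

instantiation alg_AC :: (real_or_complex, finite, sign) "{ring, monoid_mult}"
begin

lift_definition zero_alg_AC :: "('a, 'b, 'c) alg_AC" is 0 .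
lift_definition one_alg_AC :: "('a, 'b, 'c) alg_AC" is 1 .
lift_definition plus_alg_AC :: "('a, 'b, 'c) alg_AC \<Rightarrow> ('a, 'b, 'c) alg_AC \<Rightarrow> ('a, 'b, 'c) alg_AC"
  is "(+)" by (rule cong_mod_add)
lift_definition minus_alg_AC :: "('a, 'b, 'c) alg_AC \<Rightarrow> ('a, 'b, 'c) alg_AC \<Rightarrow> ('a, 'b, 'c) alg_AC"
  is "(-)" by (rule cong_mod_diff)
lift_definition uminus_alg_AC :: "('a, 'b, 'c) alg_AC \<Rightarrow> ('a, 'b, 'c) alg_AC"
  is uminus by (rule cong_mod_uminus)
lift_definition times_alg_AC :: "('a, 'b, 'c) alg_AC \<Rightarrow> ('a, 'b, 'c) alg_AC \<Rightarrow> ('a, 'b, 'c) alg_AC"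
  is "(*)" by (rule cong_mod_mult)

instance
  by standard (transfer; simp add: algebra_simps cong_mod_refl)+

end

lift_definition scale :: "'k \<Rightarrow> ('k::real_or_complex, 'n::finite, 's::sign) alg_AC \<Rightarrow> ('k, 'n, 's) alg_AC"
    (infixr "*\<^sub>K" 75)
  is "\<lambda>c a. scal c * a"
  by (intro cong_mod_mult cong_mod_refl)

definition tensor :: "('k::real_or_complex, 'n::finite) alg_A \<Rightarrow> ('k, 'n, 's::sign) clifford \<Rightarrow>
    ('k, 'n, 's) alg_AC" (infixl "\<otimes>" 78) where
  "a \<otimes> c = abs_alg_AC (pure a c)"


section \<open>The operators\<close>

definition eps :: "('k::real_or_complex, 'n::finite, 's::sign) alg_AC" where
  "eps = of_int (sign_val TYPE('s)) *\<^sub>K 1"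

definition x_AC :: "'n \<Rightarrow> ('k::real_or_complex, 'n::finite, 's::sign) alg_AC" where
  "x_AC i = x_A i \<otimes> 1"

definition p_AC :: "'n \<Rightarrow> ('k::real_or_complex, 'n::finite, 's::sign) alg_AC" where
  "p_AC i = p_A i \<otimes> 1"

definition e_AC :: "'n \<Rightarrow> ('k::real_or_complex, 'n::finite, 's::sign) alg_AC" where
  "e_AC i = 1 \<otimes> e_C i"

definition D_op :: "('k::real_or_complex, 'n::finite, 's::sign) alg_AC" where
  "D_op = (\<Sum>i\<in>UNIV. e_AC i * p_AC i)"

definition e_list :: "'n list \<Rightarrow> ('k::real_or_complex, 'n::finite, 's::sign) alg_AC" where
  "e_list A = prod_list (map e_AC A)"

definition x_vec :: "'n set \<Rightarrow> ('k::real_or_complex, 'n::finite, 's::sign) alg_AC" where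
  "x_vec S = (\<Sum>s\<in>S. x_AC s * e_AC s)"

definition list_inter :: "'n list \<Rightarrow> 'n list \<Rightarrow> 'n list" where
  "list_inter A B = filter (\<lambda>a. a \<in> set B) A"

definition index_set :: "'n list list \<Rightarrow> 'n set" where
  "index_set As = foldr (\<lambda>A S. sym_diff (set A) S) As {}"

text \<open>\<open>O_op [A\<^sub>1, \<dots>, A\<^sub>r]\<close> is the element $O_{A_1,\dots,A_r}$.\<close>

definition O_op :: "'n list list \<Rightarrow> ('k::real_or_complex, 'n::finite, 's::sign) alg_AC" where
  "O_op As = (let S = index_set As; E = prod_list (map e_list As) in
     (1/2) *\<^sub>K (D_op * x_vec S * E - E * x_vec S * D_op - eps * E))"

text \<open>
  The supercommutator with subscript \<open>+\<close> of \<open>O_op As\<close> and \<open>O_op Bs\<close>. It takes the labels as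
  arguments because the index sets belong to the labels and not to the elements. The exponent
  involves no truncation, since \<open>card (S \<inter> T) \<le> card S * card T\<close>.
\<close>

definition supercomm_plus :: "'n list list \<Rightarrow> 'n list list \<Rightarrow>
    ('k::real_or_complex, 'n::finite, 's::sign) alg_AC" where
  "supercomm_plus As Bs = (let S = index_set As; T = index_set Bs in
     O_op As * O_op Bs + (- 1) ^ (card S * card T - card (S \<inter> T)) * (O_op Bs * O_op As))"

end

(*
Moving E = e_{A_1} ... e_{A_r} to the right gives O_{A_1,...,A_r} = (1/2) (t_S - eps) E, where t_S
depends on the index set S only. The sign in the supercommutator is the one that turns E_2 E_1 into
E_1 E_2, so the supercommutator of two operators with index sets S and T is (1/4) q(S,T) E_1 E_2 with
  q(S,T) = (t_S - eps) (t_T - eps)^S + (t_T - eps) (t_S - eps)^T,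
where ^S is conjugation by e_S. As e_{A \cap B} squares to 1 or -1, the theorem becomes,
for S = A \ B, T = B \ A and U = A \cap B,
  q(S \cup U, T \cup U) = q(S,T) + q(U, S \cup T \cup U) + 2 eps (t_{S \cup T} - eps).
Decompose D and x along S, T, U and the complement V. What remains is a combination of three
quadratic relations between the components, which follow from the Jacobi identity and three
properties of the vectors D_S, x_S for disjoint S, T: D_S and D_T anticommute, so do x_S and x_T,
and {D_S, x_T} = - {D_T, x_S}. The last one expresses that [p_i, x_j] is symmetric in i and j.
*)

theory Submission
  imports Defs
begin

section \<open>Pairs of anticommuting families of vectors\<close>

text \<open>\<open>d S\<close> and \<open>x S\<close> stand for the parts of \<open>D_op\<close> and
  of the position vector supported in \<open>S\<close>. These rules carry the quadratic
  computations, which thereby avoid the Clifford generators. A \<open>ring\<close> has no numeral 2,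
  so doubles are written as sums.\<close>

locale odd_vectors =
  fixes d x :: "'n set \<Rightarrow> 'r::ring"
  assumes d_Un: "disjnt S T \<Longrightarrow> d (S \<union> T) = d S + d T"
    and x_Un: "disjnt S T \<Longrightarrow> x (S \<union> T) = x S + x T"
    and d_anticomm: "disjnt S T \<Longrightarrow> d S * d T + d T * d S = 0"
    and x_anticomm: "disjnt S T \<Longrightarrow> x S * x T + x T * x S = 0"
    and dx_antisym: "disjnt S T \<Longrightarrow> (d S * x T + x T * d S) + (d T * x S + x S * d T) = 0"
begin

text \<open>
  \<open>m\<close>, \<open>w\<close> and \<open>k\<close> are the homogeneous components of \<open>twisted\<close> below with respect to a partition
  of the index set. The component usually written \<open>[d S, x T] + [d T, x S]\<close> is \<open>w S T + w S T\<close>, cf.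
  \<open>w_double\<close>.
\<close>

definition m :: "'n set \<Rightarrow> 'n set \<Rightarrow> 'r" where
  "m S T = d S * x T + x T * d S"

definition w :: "'n set \<Rightarrow> 'n set \<Rightarrow> 'r" where
  "w S T = d S * x T + d T * x S"

definition k :: "'n set \<Rightarrow> 'r" where
  "k S = d S * x S - x S * d S"

lemma m_antisym: "disjnt S T \<Longrightarrow> m T S = - m S T"
  unfolding m_def eq_neg_iff_add_eq_0 using dx_antisym[of S T] by (simp add: add.commute)

text \<open>The rule \<open>dx_antisym\<close> trades products with \<open>d\<close> first for
  products with \<open>x\<close> first. Below, a left factor \<open>w\<close> is expanded by its
  definition and a right factor by this form.\<close>

lemma w_alt: "disjnt S T \<Longrightarrow> w S T = - (x S * d T + x T * d S)"
  unfolding w_def eq_neg_iff_add_eq_0 using dx_antisym[of S T] by (simp add: algebra_simps)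

lemma w_double:
  assumes "disjnt S T"
  shows "w S T + w S T = (d S * x T + d T * x S) - (x S * d T + x T * d S)"
proof -
  have "w S T + w S T = w S T + - (x S * d T + x T * d S)"
    by (simp only: w_alt[OF assms, symmetric])
  then show ?thesis
    unfolding diff_conv_add_uminus by (simp only: w_def)
qed

section \<open>Graded Jacobi identity and commutators with the mixed components\<close>

lemma w_commute: "w S T = w T S"
  by (simp add: w_def add.commute)

text \<open>This is the graded Jacobi identity for three odd elements: two odd elements are
  bracketed by the anticommutator, and the result with the third by the commutator.\<close>

lemma super_jacobi:
  fixes a b c :: "'r"
  shows "commutator a (b * c + c * b) + commutator b (a * c + c * a) + commutator c (a * b + b * a) = 0"
  by (simp add: commutator_def algebra_simps)

lemma commutator_zero [simp]: "commutator (a :: 'r) 0 = 0"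
  by (simp add: commutator_def)

lemma commutator_minus [simp]: "commutator (a :: 'r) (- b) = - commutator a b"
  by (simp add: commutator_def)

text \<open>In the graded Jacobi identity for \<open>d S\<close>, \<open>d T\<close>,
  \<open>x U\<close> the anticommutator of \<open>d S\<close> and \<open>d T\<close> vanishes. The
  instance \<open>T = U\<close> is used as well.\<close>

lemma comm_d_m: "disjnt S T \<Longrightarrow> commutator (d S) (m T U) = - commutator (d T) (m S U)"
  using super_jacobi[of "d S" "d T" "x U"] d_anticomm[of S T]
  by (simp only: m_def eq_neg_iff_add_eq_0 commutator_zero add_0_right)

lemma comm_x_m: "disjnt S U \<Longrightarrow> commutator (x S) (m T U) = - commutator (x U) (m T S)"
  using super_jacobi[of "x S" "x U" "d T"] x_anticomm[of S U]
  by (simp only: m_def eq_neg_iff_add_eq_0 commutator_zero add_0_right add.commute[of "d T * z" for z])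

lemma comm_x_m_same: "commutator (x S) (m T S) = x S * x S * d T - d T * (x S * x S)"
  by (simp add: m_def commutator_def algebra_simps)

section \<open>Quadratic relations between the components\<close>

lemma commutator_w:
  "commutator (w S T) z = d S * commutator (x T) z + commutator (d S) z * x T
    + d T * commutator (x S) z + commutator (d T) z * x S"
  by (simp add: w_def commutator_def algebra_simps)

text \<open>The commutators of \<open>d A\<close> and of \<open>x A\<close> with
  \<open>m V B\<close> change sign when \<open>A\<close> and \<open>B\<close> are exchanged, so the
  terms of the Leibniz expansion cancel in pairs.\<close>

lemma w_m_cyclic:
  assumes "disjnt S T" "disjnt S U" "disjnt T U" "disjnt V S" "disjnt V T" "disjnt V U"
  shows "commutator (w S U) (m V T) + commutator (w T U) (m V S) + commutator (w S T) (m V U) = 0"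
proof -
  have x: "commutator (x U) (m V T) = - commutator (x T) (m V U)"
     "commutator (x U) (m V S) = - commutator (x S) (m V U)"
     "commutator (x T) (m V S) = - commutator (x S) (m V T)"
    using assms by (auto intro!: comm_x_m simp: disjnt_sym)
  \<comment> \<open>\<open>comm_d_m\<close> exchanges the set of the single vector with the first
    argument of \<open>m\<close>, so \<open>B\<close> is first moved there by antisymmetry.\<close>
  have swap: "commutator (d A) (m V B) = - commutator (d B) (m V A)"
    if "disjnt A B" "disjnt V A" "disjnt V B" for A B
    using comm_d_m[of A B V] m_antisym[of V A] m_antisym[of V B] that
    by (metis commutator_minus minus_minus)
  have d: "commutator (d U) (m V T) = - commutator (d T) (m V U)"
     "commutator (d U) (m V S) = - commutator (d S) (m V U)"
     "commutator (d T) (m V S) = - commutator (d S) (m V T)"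
    using assms by (auto intro!: swap simp: disjnt_sym)
  show ?thesis
    unfolding commutator_w x d by simp
qed

text \<open>Let R be \<open>d S * ?s * d T + d T * ?s * d S\<close>. The first two lines of the
  claim amount to the commutator of \<open>w S T\<close> with \<open>?h\<close> minus twice R. By
  the graded Jacobi identity this commutator and the two in the last line add up to twice R.\<close>

lemma w_w_relation:
  assumes "disjnt S T" "disjnt S U" "disjnt T U"
  shows "(w S U * w T U + w T U * w S U) + (w S U * w T U + w T U * w S U)
    + (k U * w S T + w S T * k U)
    + commutator (w S U) (m T U) + commutator (w T U) (m S U) = 0"
proof -
  let ?h = "d U * x U + x U * d U" and ?s = "x U * x U"
  have xTS: "x T * x S = - (x S * x T)"
    unfolding eq_neg_iff_add_eq_0 using x_anticomm[of T S] assms by (simp add: disjnt_sym)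
  have xTS': "x T * (x S * z) = - (x S * (x T * z))" for z
    by (metis mult.assoc mult_minus_left xTS)
  have dTS: "d T * d S = - (d S * d T)"
    unfolding eq_neg_iff_add_eq_0 using d_anticomm[of T S] assms by (simp add: disjnt_sym)
  have dTS': "d T * (d S * z) = - (d S * (d T * z))" for z
    by (metis mult.assoc mult_minus_left dTS)
  have w: "d S * x T + d T * x S = w S T" "x T * d S + x S * d T = - w S T"
    using w_alt[OF assms(1)] by (auto simp: w_def)
  have "w S U * w T U + w T U * w S U =
     (d S * x U + d U * x S) * - (x T * d U + x U * d T)
     + (d T * x U + d U * x T) * - (x S * d U + x U * d S)"
    by (simp only: w_def[symmetric] w_alt[OF assms(2), symmetric] w_alt[OF assms(3), symmetric])
  also have "\<dots> = - (d S * ?s * d T + d T * ?s * d S)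
      - (d S * x U * x T + d T * x U * x S) * d U - d U * (x S * x U * d T + x T * x U * d S)"
    by (simp add: algebra_simps xTS xTS')
  also have "d S * x U * x T + d T * x U * x S = - (d S * x T + d T * x S) * x U"
  proof -
    have "x U * x T = - (x T * x U)" "x U * x S = - (x S * x U)"
      unfolding eq_neg_iff_add_eq_0 using x_anticomm[of U] assms by (auto simp: disjnt_sym)
    then show ?thesis by (simp add: algebra_simps)
  qed
  also have "x S * x U * d T + x T * x U * d S = - x U * (x T * d S + x S * d T)"
  proof -
    have "x T * x U = - (x U * x T)" "x S * x U = - (x U * x S)"
      unfolding eq_neg_iff_add_eq_0 using x_anticomm[of _ U] assms by auto
    then show ?thesis by (simp add: algebra_simps)
  qed
  finally have ww: "w S U * w T U + w T U * w S U =
      - (d S * ?s * d T + d T * ?s * d S) + w S T * (x U * d U) - d U * x U * w S T"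
    unfolding w by (simp add: mult.assoc)
  \<comment> \<open>Here two of the three sets coincide: \<open>?h\<close> is
    \<open>m U U\<close>.\<close>
  have h: "commutator (d S) ?h = - commutator (d U) (m S U)"
    "commutator (d T) ?h = - commutator (d U) (m T U)"
    "commutator (x S) ?h = commutator (x U) (m S U)"
    "commutator (x T) ?h = commutator (x U) (m T U)"
    using comm_d_m[of S U U] comm_d_m[of T U U] comm_x_m[of S U U] comm_x_m[of T U U]
      m_antisym[of S U] m_antisym[of T U] assms
    by (simp_all add: m_def[of U U, symmetric])
  have c: "commutator (d T) (m S U) = - commutator (d S) (m T U)"
    "commutator (x T) (m S U) = - commutator (x S) (m T U)"
    using comm_d_m[of S T U] comm_x_m[of S T U] m_antisym[of S U] m_antisym[of T U] assms
      comm_x_m[of T S U]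
    by (simp_all add: disjnt_sym)
  have "commutator (w S T) ?h + commutator (w S U) (m T U) + commutator (w T U) (m S U)
     = (d S * commutator (x U) (m T U) + d T * commutator (x U) (m S U))
     + (d S * commutator (x U) (m T U) + d T * commutator (x U) (m S U))"
    unfolding commutator_w h c by (simp add: algebra_simps)
  also have "d S * commutator (x U) (m T U) + d T * commutator (x U) (m S U)
      = d S * ?s * d T + d T * ?s * d S"
    unfolding comm_x_m_same by (simp add: algebra_simps dTS dTS')
  finally show ?thesis
    unfolding ww by (simp add: commutator_def k_def algebra_simps)
qed

text \<open>Expanding the commutator of \<open>w S T\<close> and \<open>k U\<close> around the
  anticommutators it contains, everything combines into commutators of single vectors with
  \<open>m S U\<close> and \<open>m T U\<close>. Those with \<open>x U\<close> are commutators of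
  \<open>x U * x U\<close> with \<open>d S\<close> or \<open>d T\<close>, and they cancel since
  \<open>d S\<close> and \<open>d T\<close> anticommute.\<close>

lemma w_k_relation:
  assumes "disjnt S T" "disjnt S U" "disjnt T U"
  shows "(m S U * w T U + w T U * m S U) + (m T U * w S U + w S U * m T U)
    + commutator (w S T) (k U) = 0"
proof -
  let ?a = "d S" and ?b = "d T" and ?c = "d U" and ?A = "x S" and ?B = "x T" and ?C = "x U"
  let ?ma = "m S U" and ?mb = "m T U"
  have ac: "?a * ?c = - (?c * ?a)" "?b * ?c = - (?c * ?b)"
    unfolding eq_neg_iff_add_eq_0 using d_anticomm[of _ U] assms by auto
  have ac': "?a * (?c * z) = - (?c * (?a * z))" "?b * (?c * z) = - (?c * (?b * z))" for z
    by (metis mult.assoc mult_minus_left ac)+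
  have AC: "?C * ?A = - (?A * ?C)" "?C * ?B = - (?B * ?C)"
    unfolding eq_neg_iff_add_eq_0 using x_anticomm[of _ U] assms by (simp_all add: add.commute)
  have AC': "?C * (?A * z) = - (?A * (?C * z))" "?C * (?B * z) = - (?B * (?C * z))" for z
    by (metis mult.assoc mult_minus_left AC)+
  have ba: "?b * ?a = - (?a * ?b)"
    unfolding eq_neg_iff_add_eq_0 using d_anticomm[of T S] assms by (simp add: disjnt_sym)
  have ba': "?b * (?a * z) = - (?a * (?b * z))" for z
    by (metis mult.assoc mult_minus_left ba)
  have mc: "?c * ?A + ?A * ?c = - ?ma" "?c * ?B + ?B * ?c = - ?mb"
    using m_antisym[OF assms(2)] m_antisym[OF assms(3)] by (simp_all add: m_def)
  have ma: "?a * ?C + ?C * ?a = ?ma" "?b * ?C + ?C * ?b = ?mb"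
    by (simp_all add: m_def)
  have "commutator (w S T) (k U) =
      ?a * (?c * ?B + ?B * ?c) * ?C - ?c * (?a * ?C + ?C * ?a) * ?B
    + ?b * (?c * ?A + ?A * ?c) * ?C - ?c * (?b * ?C + ?C * ?b) * ?A
    - ?C * ?a * (?c * ?B + ?B * ?c) + (?a * ?C + ?C * ?a) * ?B * ?c
    - ?C * ?b * (?c * ?A + ?A * ?c) + (?b * ?C + ?C * ?b) * ?A * ?c"
    by (simp add: commutator_def w_def k_def algebra_simps ac ac' AC AC')
  then have wk: "commutator (w S T) (k U) =
    - ?a * ?mb * ?C - ?c * ?ma * ?B - ?b * ?ma * ?C - ?c * ?mb * ?A
    + ?C * ?a * ?mb + ?ma * ?B * ?c + ?C * ?b * ?ma + ?mb * ?A * ?c"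
    unfolding mc ma by (simp add: algebra_simps)
  have mw: "?ma * w T U + w T U * ?ma = ?ma * - (?B * ?c + ?C * ?b) + (?b * ?C + ?c * ?B) * ?ma"
    "?mb * w S U + w S U * ?mb = ?mb * - (?A * ?c + ?C * ?a) + (?a * ?C + ?c * ?A) * ?mb"
    by (simp_all only: w_def[symmetric] w_alt[OF assms(2), symmetric] w_alt[OF assms(3), symmetric])
  have "(?ma * w T U + w T U * ?ma) + (?mb * w S U + w S U * ?mb) + commutator (w S T) (k U)
    = (?a * commutator ?C ?mb + commutator ?C ?mb * ?a) + (?b * commutator ?C ?ma + commutator ?C ?ma * ?b)
      + ?c * (commutator ?B ?ma + commutator ?A ?mb) + ?C * (commutator ?a ?mb + commutator ?b ?ma)"
    unfolding wk mw by (simp add: commutator_def algebra_simps)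
  also have "commutator ?B ?ma + commutator ?A ?mb = 0"
    using comm_x_m[of S T U] m_antisym[of S U] m_antisym[of T U] assms
    by (metis add.commute commutator_minus eq_neg_iff_add_eq_0 neg_equal_iff_equal)
  also have "commutator ?a ?mb + commutator ?b ?ma = 0"
    using comm_d_m[of S T U] assms by simp
  also have "(?a * commutator ?C ?mb + commutator ?C ?mb * ?a) + (?b * commutator ?C ?ma + commutator ?C ?ma * ?b) = 0"
    unfolding comm_x_m_same by (simp add: algebra_simps ba ba')
  finally show ?thesis by simp
qed

text \<open>
  With \<open>E\<close> a product of Clifford generators with index set \<open>S\<close>, conjugation by \<open>E\<close> acts on the vectors
  supported in \<open>S\<close> and on those supported in \<open>- S\<close> by opposite signs. Hence \<open>twisted S T\<close> is the
  conjugate by \<open>E\<close> of \<open>twisted UNIV T\<close>, and \<open>twisted UNIV T - \<epsilon>\<close> is twice the coefficient of \<open>e\<^sub>T\<close> in \<open>O\<^sub>T\<close>.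
\<close>

definition twisted :: "'n set \<Rightarrow> 'n set \<Rightarrow> 'r" where
  "twisted S T = (d S - d (- S)) * (x (T \<inter> S) - x (T - S))
    - (x (T \<inter> S) - x (T - S)) * ((d (T \<inter> S) - d (T - S)) - (d (S - T) - d (- (S \<union> T))))"

text \<open>\<open>pair_product\<close> and \<open>pair_sum\<close> are the parts of
  \<open>quad\<close> below that are quadratic and linear in \<open>twisted\<close>; separating them
  keeps \<open>eps\<close> out of the locale.\<close>

definition pair_product :: "'n set \<Rightarrow> 'n set \<Rightarrow> 'r" where
  "pair_product S T = twisted UNIV S * twisted S T + twisted UNIV T * twisted T S"

definition pair_sum :: "'n set \<Rightarrow> 'n set \<Rightarrow> 'r" where
  "pair_sum S T = twisted UNIV S + twisted S T + twisted UNIV T + twisted T S"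

section \<open>Values of \<open>twisted\<close> on a partition of the indices\<close>

lemma d_empty [simp]: "d {} = 0" and x_empty [simp]: "x {} = 0"
  using d_Un[of "{}" "{}"] x_Un[of "{}" "{}"] by auto

text \<open>In the two products of \<open>twisted\<close>, \<open>d I\<close> and \<open>d K\<close>
  carry the same signs and give commutators, while \<open>d J\<close> and \<open>d N\<close> carry
  opposite signs and give anticommutators.\<close>

lemma twisted_eq:
  assumes "I = T \<inter> S" "K = T - S" "J = S - T" "N = - (S \<union> T)"
  shows "twisted S T = k I + k K - (w I K + w I K) + m J I - m J K - m N I + m N K"
proof -
  have "S = I \<union> J" "- S = K \<union> N" "disjnt I J" "disjnt K N" "disjnt I K"
    using assms by (auto simp: disjnt_def)
  then have "d S = d I + d J" "d (- S) = d K + d N"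
    using d_Un by auto
  then show ?thesis
    unfolding twisted_def assms(1-4)[symmetric] w_double[OF \<open>disjnt I K\<close>]
    by (simp add: k_def m_def algebra_simps)
qed

lemma twisted_UNIV: "twisted UNIV S = k S + m (- S) S"
  using twisted_eq[of S S UNIV "{}" "- S" "{}"] by (simp add: Compl_eq_Diff_UNIV k_def m_def w_def)

lemma k_Un: "disjnt S T \<Longrightarrow> k (S \<union> T) = k S + k T + (w S T + w S T)"
  by (simp add: w_double d_Un x_Un k_def algebra_simps)

lemma m_Un: "disjnt S T \<Longrightarrow> m (S \<union> T) U = m S U + m T U"
    "disjnt S T \<Longrightarrow> m U (S \<union> T) = m U S + m U T"
  using d_Un x_Un by (auto simp: m_def algebra_simps)

lemma w_Un: "disjnt S T \<Longrightarrow> w U (S \<union> T) = w U S + w U T"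
  using d_Un x_Un by (auto simp: w_def algebra_simps)

lemma m_w_empty [simp]: "m {} S = 0" "m S {} = 0" "w S {} = 0" "w {} S = 0" "k {} = 0"
  by (auto simp: m_def w_def k_def)

text \<open>Every value of \<open>twisted\<close> that occurs is a combination of \<open>k\<close>,
  \<open>w\<close> and \<open>m\<close> on \<open>S\<close>, \<open>T\<close>, \<open>U\<close> and
  the remaining indices \<open>V\<close>. The identity for sums is then linear bookkeeping; the one
  for products needs the quadratic relations.\<close>

lemma pair_identity:
  assumes "disjnt S T" "disjnt S U" "disjnt T U"
  shows "pair_product (S \<union> U) (T \<union> U) = pair_product S T + pair_product U (S \<union> T \<union> U)"
    and "pair_sum (S \<union> U) (T \<union> U) + (twisted UNIV (S \<union> T) + twisted UNIV (S \<union> T)) = pair_sum S T + pair_sum U (S \<union> T \<union> U)"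
proof -
  define V where "V = - (S \<union> T \<union> U)"
  have disj: "disjnt S T" "disjnt S U" "disjnt T U" "disjnt V S" "disjnt V T" "disjnt V U"
    using assms by (auto simp: V_def disjnt_def)
  have disj': "disjnt (S \<union> T) U" "disjnt S (U \<union> V)" "disjnt T (U \<union> V)" "disjnt S (T \<union> V)" "disjnt U V"
      "disjnt T V" "disjnt S V"
    using disj by (auto simp: disjnt_def)
  \<comment> \<open>With these rules the arguments of \<open>m\<close> and \<open>w\<close> end up
    in the order \<open>V\<close>, \<open>S\<close>, \<open>T\<close>, \<open>U\<close>.\<close>
  note m = m_antisym[OF disj(1)] m_antisym[OF disj(2)] m_antisym[OF disj(3)]
    m_Un[OF disj(1)] m_Un[OF disj(2)] m_Un[OF disj(3)] m_Un[OF disj'(1)] m_Un[OF disj'(2)] m_Un[OF disj'(3)]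
    m_Un[OF disj'(4)] m_Un[OF disj'(5)] m_Un[OF disj'(6)] m_Un[OF disj'(7)]
    k_Un[OF disj(1)] k_Un[OF disj(2)] k_Un[OF disj(3)] k_Un[OF disj'(1)]
    w_Un[OF disj(1)] w_Un[OF disj(2)] w_Un[OF disj(3)] w_Un[OF disj'(1)]
    w_commute[of U S] w_commute[of T S] w_commute[of U T] w_commute[of "S \<union> T" U]
  have compl: "- (S \<union> U) = T \<union> V" "- (T \<union> U) = S \<union> V" "- (S \<union> T) = U \<union> V"
    "- S = T \<union> (U \<union> V)" "- T = S \<union> (U \<union> V)" "- U = S \<union> (T \<union> V)" "- (S \<union> T \<union> U) = V"
    using disj by (auto simp: V_def disjnt_def)
  have SU: "twisted UNIV (S \<union> U) = k S + k U + (w S U + w S U) - m S T + m T U + m V S + m V U"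
    and TU: "twisted UNIV (T \<union> U) = k T + k U + (w T U + w T U) + m S T + m S U + m V T + m V U"
    and S: "twisted UNIV S = k S - m S T - m S U + m V S"
    and T: "twisted UNIV T = k T + m S T - m T U + m V T"
    and U: "twisted UNIV U = k U + m S U + m T U + m V U"
    and ST: "twisted UNIV (S \<union> T) = k S + k T + (w S T + w S T) - m S U - m T U + m V S + m V T"
    and STU: "twisted UNIV (S \<union> T \<union> U) = k S + k T + k U + (w S T + w S T) + (w S U + w S U) + (w T U + w T U)
      + m V S + m V T + m V U"
    unfolding twisted_UNIV compl m by (simp_all add: algebra_simps)
  \<comment> \<open>The sets supplied to \<open>twisted_eq\<close> are the intersection of both
    arguments, the second minus the first, the first minus the second, and the complement of the
    union.\<close>
  have 1: "twisted (S \<union> U) (T \<union> U) = k U + k T - (w T U + w T U) - m S T + m S U + m V T - m V U"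
    by (rule trans[OF twisted_eq[of U _ _ T S V]]; use disj in \<open>(auto simp: V_def disjnt_def; fail)?\<close>) (simp add: m algebra_simps)
  have 2: "twisted (T \<union> U) (S \<union> U) = k U + k S - (w S U + w S U) + m S T + m T U + m V S - m V U"
    by (rule trans[OF twisted_eq[of U _ _ S T V]]; use disj in \<open>(auto simp: V_def disjnt_def; fail)?\<close>) (simp add: m algebra_simps)
  have 3: "twisted S T = k T - m S T - m T U + m V T"
    by (rule trans[OF twisted_eq[of "{}" _ _ T S "U \<union> V"]]; use disj in \<open>(auto simp: V_def disjnt_def; fail)?\<close>) (simp add: m algebra_simps)
  have 4: "twisted T S = k S + m S T - m S U + m V S"
    by (rule trans[OF twisted_eq[of "{}" _ _ S T "U \<union> V"]]; use disj in \<open>(auto simp: V_def disjnt_def; fail)?\<close>) (simp add: m algebra_simps)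
  have 5: "twisted U (S \<union> T \<union> U) = k U + k S + k T + (w S T + w S T) - (w S U + w S U) - (w T U + w T U)
    + m V S + m V T - m V U"
    by (rule trans[OF twisted_eq[of U _ _ "S \<union> T" "{}" V]]; use disj in \<open>(auto simp: V_def disjnt_def; fail)?\<close>) (simp add: m algebra_simps)
  have 6: "twisted (S \<union> T \<union> U) U = k U + m S U + m T U - m V U"
    by (rule trans[OF twisted_eq[of U _ _ "{}" "S \<union> T" V]]; use disj in \<open>(auto simp: V_def disjnt_def; fail)?\<close>) (simp add: m algebra_simps)
  note tw = SU TU S T U ST STU 1 2 3 4 5 6
  show "pair_sum (S \<union> U) (T \<union> U) + (twisted UNIV (S \<union> T) + twisted UNIV (S \<union> T)) = pair_sum S T + pair_sum U (S \<union> T \<union> U)"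
    unfolding pair_sum_def tw by simp
  define r1 where "r1 = (m S T * w T U + w T U * m S T) - (m T U * w S T + w S T * m T U)
    + commutator (w S U) (k T)"
  define r2 where "r2 = (- m S T * w S U - w S U * m S T) - (m S U * w S T + w S T * m S U)
    + commutator (w T U) (k S)"
  define r3 where "r3 = (w S U * w T U + w T U * w S U) + (w S U * w T U + w T U * w S U)
    + (k U * w S T + w S T * k U)
    + commutator (w S U) (m T U) + commutator (w T U) (m S U)"
  define r4 where "r4 = commutator (w S U) (m V T) + commutator (w T U) (m V S) + commutator (w S T) (m V U)"
  \<comment> \<open>\<open>r1\<close> and \<open>r2\<close> are \<open>w_k_relation\<close> with
    \<open>T\<close> and \<open>S\<close> as the distinguished set, \<open>r3\<close> is
    \<open>w_w_relation\<close> with \<open>U\<close>, and \<open>r4\<close> is the cyclic relation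
    with \<open>V\<close>.\<close>
  have "pair_product (S \<union> U) (T \<union> U) - pair_product S T - pair_product U (S \<union> T \<union> U) = (r1 + r1) + (r2 + r2) - (r3 + r3) + (r4 + r4)"
    unfolding pair_product_def tw r1_def r2_def r3_def r4_def commutator_def by (simp add: algebra_simps)
  also have "r1 = 0"
    using w_k_relation[of S U T] disj unfolding r1_def m
    by (simp add: disjnt_sym w_commute[of U T] algebra_simps)
  also have "r2 = 0"
    using w_k_relation[of T U S] disj unfolding r2_def m
    by (simp add: disjnt_sym w_commute[of U S] m algebra_simps)
  also have "r3 = 0"
    using w_w_relation[of S T U] disj unfolding r3_def by simp
  also have "r4 = 0"
    using w_m_cyclic[of S T U V] disj unfolding r4_def by simp
  finally show "pair_product (S \<union> U) (T \<union> U) = pair_product S T + pair_product U (S \<union> T \<union> U)"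
    by (simp add: algebra_simps)
qed

end

section \<open>Relations in the tensor product\<close>

text \<open>Scalars sit at the neutral element of the monoid and so commute with each monomial; the
  induction adds one monomial at a time.\<close>

lemma scal_commute: "scal c * a = a * scal c"
proof (induction a rule: update_induct)
  case const
  then show ?case by simp
next
  case (update f k v)
  then have "Poly_Mapping.update k v f = Poly_Mapping.single k v + f"
    by (intro poly_mapping_eqI) (auto simp: lookup_update lookup_add lookup_single in_keys_iff)
  with update show ?case
    by (simp add: scal_def distrib_left distrib_right mult_single mult.commute)
qed

lemma scale_add_right: "c *\<^sub>K (a + b) = c *\<^sub>K a + c *\<^sub>K b"
  by transfer (simp add: distrib_left cong_mod_refl)

lemma scale_add_left: "(c + c') *\<^sub>K a = c *\<^sub>K a + c' *\<^sub>K a"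
  by transfer (simp add: scal_def single_add distrib_right cong_mod_refl)

lemma scale_mult_left: "(c *\<^sub>K a) * b = c *\<^sub>K (a * b)"
  by transfer (simp add: mult.assoc cong_mod_refl)

lemma scale_mult_right: "a * (c *\<^sub>K b) = c *\<^sub>K (a * b)"
proof transfer
  fix a b :: "(('a, 'b) alg_A, ('a, 'b, 'c) clifford) pair \<Rightarrow>\<^sub>0 'a" and c
  have "a * (scal c * b) = scal c * (a * b)"
    by (metis mult.assoc scal_commute)
  then show "cong_mod (tensor_rels scale_A scale_C) (a * (scal c * b)) (scal c * (a * b))"
    by (simp add: cong_mod_refl)
qed

lemma scale_scale: "c *\<^sub>K c' *\<^sub>K a = (c * c') *\<^sub>K a"
  by transfer (simp add: mult.assoc[symmetric] scal_def mult_single cong_mod_refl)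

lemma scale_one: "1 *\<^sub>K a = a"
  by transfer (simp add: scal_def cong_mod_refl)

lemma scale_minus_one: "(- 1) *\<^sub>K a = - a"
  by transfer (simp add: scal_def single_uminus cong_mod_refl)

lemma scale_minus:
  fixes a :: "('k::real_or_complex, 'n::finite, 's::sign) alg_AC"
  shows "k *\<^sub>K (- a) = - (k *\<^sub>K a)"
proof -
  have "k *\<^sub>K (0 :: ('k, 'n, 's) alg_AC) = 0"
    using scale_add_right[of k "0 :: ('k, 'n, 's) alg_AC" 0] by simp
  then have "k *\<^sub>K a + k *\<^sub>K (- a) = 0"
    unfolding scale_add_right[symmetric] by simp
  then show ?thesis
    by (simp add: eq_neg_iff_add_eq_0 add.commute)
qed

lemma scale_half_double: "(1/2) *\<^sub>K (a + a) = a"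
  using scale_add_left[of "1/2" "1/2" a] by (simp add: scale_add_right scale_one)

section \<open>Products and bilinearity of pure tensors\<close>

lemma tensor_mult: "(a \<otimes> c) * (a' \<otimes> c') = (a * a') \<otimes> (c * c')"
  unfolding tensor_def times_alg_AC.abs_eq by (simp add: pure_def mult_single)

lemma abs_alg_AC_eqI: "r \<in> tensor_rels scale_A scale_C \<Longrightarrow> a - b = r \<Longrightarrow> abs_alg_AC a = abs_alg_AC b"
  unfolding alg_AC.abs_eq_iff cong_mod_def using ideal_gen.gen[of r _ 1 1] by simp

lemma tensor_add_left: "(a + a') \<otimes> c = a \<otimes> c + a' \<otimes> c"
  unfolding tensor_def plus_alg_AC.abs_eq
  by (rule abs_alg_AC_eqI[of "pure (a + a') c - pure a c - pure a' c"]) (unfold tensor_rels_def, blast, simp)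

lemma tensor_add_right: "a \<otimes> (c + c') = a \<otimes> c + a \<otimes> c'"
  unfolding tensor_def plus_alg_AC.abs_eq
  by (rule abs_alg_AC_eqI[of "pure a (c + c') - pure a c - pure a c'"]) (unfold tensor_rels_def, blast, simp)

lemma tensor_scale_right: "a \<otimes> scale_C k c = k *\<^sub>K (a \<otimes> c)"
  unfolding tensor_def scale.abs_eq
  by (rule abs_alg_AC_eqI[of "pure a (scale_C k c) - scal k * pure a c"]) (unfold tensor_rels_def, blast, simp)

lemma tensor_one: "1 \<otimes> 1 = 1"
  by (simp add: tensor_def pure_def one_alg_AC_def zero_pair_def[symmetric])

section \<open>Relations inherited from the two factors\<close>

lemma abs_alg_A_eqI: "a - b \<in> A_rels \<Longrightarrow> abs_alg_A a = abs_alg_A b"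
  unfolding alg_A.abs_eq_iff cong_mod_def using ideal_gen.gen[of "a - b" _ 1 1] by simp

lemma x_A_commute: "x_A i * x_A j = x_A j * x_A i"
  unfolding x_A.abs_eq times_alg_A.abs_eq
  by (rule abs_alg_A_eqI) (auto simp: A_rels_def commutator_def)

lemma p_A_commute: "p_A i * p_A j = p_A j * p_A i"
  unfolding p_A.abs_eq times_alg_A.abs_eq
  by (rule abs_alg_A_eqI) (auto simp: A_rels_def commutator_def)

text \<open>Hides the form of \<open>h\<close>, half the sum of the squared momenta: what matters
  next is that all momenta are commutators with one common element.\<close>

lemma p_A_eq_commutator:
  obtains h :: "('k::real_or_complex, 'n::finite) alg_A"
  where "\<And>j. p_A j = commutator h (x_A j)"
proof
  fix j :: 'n
  let ?h = "scal (1/2) * (\<Sum>i\<in>UNIV. gen (P i) ^ 2) :: 'n xp word \<Rightarrow>\<^sub>0 'k"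
  have "commutator ?h (gen (X j)) - gen (P j) \<in> A_rels"
    unfolding A_rels_def by blast
  then show "p_A j = commutator (abs_alg_A ?h) (x_A j)"
    unfolding p_A.abs_eq x_A.abs_eq commutator_def times_alg_A.abs_eq minus_alg_A.abs_eq
    by (rule abs_alg_A_eqI[symmetric])
qed

text \<open>By the Jacobi identity the two sides differ by the commutator of \<open>h\<close> with
  that of \<open>x_A i\<close> and \<open>x_A j\<close>, which is zero.\<close>

lemma p_x_symmetric:
  "(commutator (p_A i) (x_A j) :: ('k::real_or_complex, 'n::finite) alg_A) = commutator (p_A j) (x_A i)"
proof -
  obtain h :: "('k, 'n) alg_A" where h: "\<And>j. p_A j = commutator h (x_A j)"
    by (rule p_A_eq_commutator) blast
  have jacobi: "commutator (commutator h a) b - commutator (commutator h b) a = commutator h (commutator a b)"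
    for a b :: "('k, 'n) alg_A"
    by (simp add: commutator_def algebra_simps)
  have "commutator (x_A i) (x_A j) = (0 :: ('k, 'n) alg_A)"
    unfolding commutator_def by (metis x_A_commute diff_self)
  then have "commutator h (commutator (x_A i) (x_A j)) = 0"
    by (simp add: commutator_def)
  then show ?thesis
    unfolding h jacobi[symmetric] eq_iff_diff_eq_0[of "commutator _ _" "commutator _ _"] .
qed

lemma x_AC_commute: "x_AC i * x_AC j = x_AC j * x_AC i"
  by (simp add: x_AC_def tensor_mult x_A_commute)

lemma p_AC_commute: "p_AC i * p_AC j = p_AC j * p_AC i"
  by (simp add: p_AC_def tensor_mult p_A_commute)

lemma e_x_commute: "e_AC i * x_AC j = x_AC j * e_AC i"
  by (simp add: x_AC_def e_AC_def tensor_mult)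

lemma e_p_commute: "e_AC i * p_AC j = p_AC j * e_AC i"
  by (simp add: p_AC_def e_AC_def tensor_mult)

text \<open>Rearranged into sums so that additivity of the tensor in its first factor
  applies.\<close>

lemma p_x_AC_symmetric:
  "(p_AC i * x_AC j + x_AC i * p_AC j :: ('k::real_or_complex, 'n::finite, 's::sign) alg_AC)
    = p_AC j * x_AC i + x_AC j * p_AC i"
proof -
  have "(p_A i * x_A j + x_A i * p_A j :: ('k, 'n) alg_A) = p_A j * x_A i + x_A j * p_A i"
    using p_x_symmetric[of i j] by (simp add: commutator_def algebra_simps)
  then show ?thesis
    by (simp add: x_AC_def p_AC_def tensor_mult tensor_add_left[symmetric])
qed

lemma e_C_anticomm:
  "(e_C i * e_C j + e_C j * e_C i :: ('k::real_or_complex, 'n::finite, 's::sign) clifford)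
    = scale_C (2 * of_int (sign_val TYPE('s)) * (if i = j then 1 else 0)) 1"
proof -
  have "a - b \<in> C_rels TYPE('s) \<Longrightarrow> (abs_clifford a :: ('k, 'n, 's) clifford) = abs_clifford b" for a b
    unfolding clifford.abs_eq_iff cong_mod_def using ideal_gen.gen[of "a - b" _ 1 1] by simp
  then show ?thesis
    unfolding e_C.abs_eq one_clifford_def scale_C.abs_eq times_clifford.abs_eq plus_clifford.abs_eq
    by (unfold C_rels_def mult_1_right) blast
qed

lemma e_AC_anticomm:
  "(e_AC i * e_AC j + e_AC j * e_AC i :: ('k::real_or_complex, 'n::finite, 's::sign) alg_AC)
    = (if i = j then eps + eps else 0)"
proof -
  let ?s = "of_int (sign_val TYPE('s)) :: 'k" and ?one = "1 :: ('k, 'n, 's) alg_AC"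
  have "(e_AC i * e_AC j + e_AC j * e_AC i :: ('k, 'n, 's) alg_AC)
      = (2 * ?s * (if i = j then 1 else 0)) *\<^sub>K ?one"
    unfolding e_AC_def tensor_mult mult_1 tensor_add_right[symmetric] e_C_anticomm tensor_scale_right tensor_one ..
  moreover have "0 *\<^sub>K ?one = 0"
    using scale_add_left[of 0 0 ?one] by simp
  moreover have "(2 * ?s) *\<^sub>K ?one = eps + eps"
    unfolding eps_def scale_add_left[symmetric] by (rule arg_cong[where f = "\<lambda>c. c *\<^sub>K ?one"]) simp
  ultimately show ?thesis by (cases "i = j") (simp_all only: simp_thms if_True if_False mult_1_right mult_zero_right)
qed

text \<open>The relation for \<open>i = j\<close> gives twice the claim, which is then scaled by
  1/2.\<close>

lemma e_AC_square: "e_AC i * e_AC i = eps"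
  using e_AC_anticomm[of i i] by (metis scale_half_double)

lemma eps_cases:
  obtains "(eps :: ('k::real_or_complex, 'n::finite, 's::sign) alg_AC) = 1"
  | "(eps :: ('k::real_or_complex, 'n::finite, 's::sign) alg_AC) = - 1"
  using sign_val[where 'a = 's] that by (auto simp: eps_def scale_one scale_minus_one)

lemma eps_commute: "eps * a = a * (eps :: ('k::real_or_complex, 'n::finite, 's::sign) alg_AC)"
  by (rule eps_cases[where 'k = 'k and 'n = 'n and 's = 's])
    (metis mult_1_left mult_1_right mult_minus_left mult_minus_right)+

section \<open>Products of Clifford generators\<close>

lemma minus_one_power: "(- 1 :: 'a::{ring, monoid_mult}) ^ n = (if even n then 1 else - 1)"
  by (induction n) auto

text \<open>Signs are encoded as booleans: they multiply by exclusive or, and parity arguments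
  become propositional.\<close>

definition sgn_if :: "bool \<Rightarrow> 'a::ring \<Rightarrow> 'a" where
  "sgn_if b a = (if b then - a else a)"

lemma sgn_if_mult: "sgn_if b a * c = sgn_if b (a * c)" "c * sgn_if b a = sgn_if b (c * a)"
  by (simp_all add: sgn_if_def)

lemma sgn_if_sgn_if: "sgn_if b (sgn_if c a) = sgn_if (b \<noteq> c) a"
  by (simp add: sgn_if_def)

lemma sgn_if_sum: "sgn_if b (sum f S) = (\<Sum>i\<in>S. sgn_if b (f i))"
  by (simp add: sgn_if_def sum_negf)

text \<open>The letters occurring an odd number of times. Since generators square to 1 or -1, these
  are the indices left in the Clifford product of the word.\<close>

definition odd_set :: "'n list \<Rightarrow> 'n set" where
  "odd_set W = foldr (\<lambda>a. sym_diff {a}) W {}"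

lemma odd_set_simps [simp]: "odd_set [] = {}" "odd_set (a # W) = sym_diff {a} (odd_set W)"
  by (simp_all add: odd_set_def)

lemma odd_set_append: "odd_set (V @ W) = sym_diff (odd_set V) (odd_set W)"
  by (induction V) auto

lemma odd_set_distinct: "distinct W \<Longrightarrow> odd_set W = set W"
  by (induction W) auto

text \<open>Allows an operator with several labels to be treated through one concatenated
  word.\<close>

lemma index_set_eq_odd_set: "(\<And>A. A \<in> set As \<Longrightarrow> distinct A) \<Longrightarrow> index_set As = odd_set (concat As)"
  by (induction As) (auto simp: index_set_def odd_set_append odd_set_distinct)

lemma even_card_sym_diff:
  fixes S T :: "'n::finite set"
  shows "even (card (sym_diff S T)) \<longleftrightarrow> (even (card S) \<longleftrightarrow> even (card T))"
proof -
  have "card (sym_diff S T) = card (S - T) + card (T - S)"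
    by (rule card_Un_disjoint) auto
  moreover have "card S = card (S - T) + card (S \<inter> T)" "card T = card (T - S) + card (S \<inter> T)"
    by (subst card_Un_disjoint[symmetric]; fastforce intro: arg_cong[where f = card])+
  ultimately show ?thesis by (simp only: even_add) blast
qed

lemma e_AC_swap: "e_AC i * e_AC j = sgn_if (i \<noteq> j) (e_AC j * e_AC i)"
  using e_AC_anticomm[of i j] by (auto simp: sgn_if_def eq_neg_iff_add_eq_0)

lemma e_list_append: "e_list (V @ W) = e_list V * e_list W"
  by (simp add: e_list_def)

text \<open>Each letter of \<open>W\<close> other than \<open>i\<close> contributes one sign, and
  the parity of their number can be read off from \<open>odd_set W\<close>.\<close>

lemma e_list_e_AC:
  "(e_list W * e_AC i :: ('k::real_or_complex, 'n::finite, 's::sign) alg_AC) = sgn_if (odd (card (odd_set W)) \<noteq> (i \<in> odd_set W)) (e_AC i * e_list W)"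
proof (induction W)
  case Nil
  then show ?case by (simp add: e_list_def sgn_if_def)
next
  case (Cons a W)
  have "(e_list (a # W) * e_AC i :: ('k, 'n, 's) alg_AC) = e_AC a * (e_list W * e_AC i)"
    by (simp add: e_list_def mult.assoc)
  also have "\<dots> = sgn_if (odd (card (odd_set W)) \<noteq> (i \<in> odd_set W)) (e_AC a * e_AC i * e_list W)"
    unfolding Cons by (simp only: sgn_if_mult mult.assoc)
  also have "e_AC a * e_AC i = sgn_if (a \<noteq> i) (e_AC i * e_AC a)"
    by (rule e_AC_swap)
  finally have eq: "(e_list (a # W) * e_AC i :: ('k, 'n, 's) alg_AC)
      = sgn_if ((odd (card (odd_set W)) \<noteq> (i \<in> odd_set W)) \<noteq> (a \<noteq> i)) (e_AC i * e_list (a # W))"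
    by (simp add: sgn_if_mult sgn_if_sgn_if e_list_def mult.assoc)
  have sign: "((odd (card (odd_set W)) \<noteq> (i \<in> odd_set W)) \<noteq> (a \<noteq> i))
     = (odd (card (odd_set (a # W))) \<noteq> (i \<in> odd_set (a # W)))"
    unfolding odd_set_simps even_card_sym_diff by auto
  show ?case
    using eq unfolding sign .
qed

text \<open>The boolean is the parity of the exponent in the supercommutator; it is built up letter
  by letter from \<open>e_list_e_AC\<close>.\<close>

lemma e_list_swap:
  "(e_list V * e_list W :: ('k::real_or_complex, 'n::finite, 's::sign) alg_AC) = sgn_if ((odd (card (odd_set V)) \<and> odd (card (odd_set W)))
     \<noteq> odd (card (odd_set V \<inter> odd_set W))) (e_list W * e_list V)"
proof (induction V)
  case Nil
  then show ?case by (simp add: e_list_def sgn_if_def)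
next
  case (Cons a V)
  let ?v = "odd_set V" and ?w = "odd_set W"
  have "(e_list (a # V) * e_list W :: ('k, 'n, 's) alg_AC) = e_AC a * (e_list V * e_list W)"
    by (simp add: e_list_def mult.assoc)
  also have "\<dots> = sgn_if ((odd (card ?v) \<and> odd (card ?w)) \<noteq> odd (card (?v \<inter> ?w))) (e_AC a * e_list W * e_list V)"
    unfolding Cons by (simp only: sgn_if_mult mult.assoc)
  also have "e_AC a * e_list W = sgn_if (odd (card ?w) \<noteq> (a \<in> ?w)) (e_list W * e_AC a)"
    unfolding e_list_e_AC by (simp add: sgn_if_def)
  finally have eq: "(e_list (a # V) * e_list W :: ('k, 'n, 's) alg_AC)
      = sgn_if (((odd (card ?v) \<and> odd (card ?w)) \<noteq> odd (card (?v \<inter> ?w))) \<noteq> (odd (card ?w) \<noteq> (a \<in> ?w)))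
         (e_list W * e_list (a # V))"
    by (simp add: sgn_if_mult sgn_if_sgn_if e_list_def mult.assoc)
  have card: "odd (card (odd_set (a # V))) \<longleftrightarrow> \<not> odd (card ?v)"
    by (simp add: even_card_sym_diff)
  have "odd_set (a # V) \<inter> ?w = sym_diff ({a} \<inter> ?w) (?v \<inter> ?w)"
    by auto
  then have card_Int: "odd (card (odd_set (a # V) \<inter> ?w)) \<longleftrightarrow> (odd (card (?v \<inter> ?w)) \<noteq> (a \<in> ?w))"
    by (cases "a \<in> ?w") (simp_all only: even_card_sym_diff, simp_all)
  have sign: "(((odd (card ?v) \<and> odd (card ?w)) \<noteq> odd (card (?v \<inter> ?w))) \<noteq> (odd (card ?w) \<noteq> (a \<in> ?w)))
     = ((odd (card (odd_set (a # V))) \<and> odd (card ?w)) \<noteq> odd (card (odd_set (a # V) \<inter> ?w)))"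
    unfolding card card_Int by blast
  show ?case
    using eq unfolding sign .
qed

text \<open>Moving the first letter next to its copy costs a sign and leaves a factor
  \<open>eps\<close>, so induction yields only 1 and -1.\<close>

lemma e_list_square_cases:
  fixes W :: "'n::finite list"
  obtains "(e_list W * e_list W :: ('k::real_or_complex, 'n, 's::sign) alg_AC) = 1"
  | "(e_list W * e_list W :: ('k::real_or_complex, 'n, 's::sign) alg_AC) = - 1"
proof -
  have "(e_list W * e_list W :: ('k, 'n, 's) alg_AC) \<in> {1, - 1}"
  proof (induction W)
    case Nil
    then show ?case by (simp add: e_list_def)
  next
    case (Cons a W)
    have "(e_list (a # W) * e_list (a # W) :: ('k, 'n, 's) alg_AC) = e_AC a * (e_list W * e_AC a) * e_list W"
      by (simp add: e_list_def mult.assoc)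
    also have "\<dots> = sgn_if (odd (card (odd_set W)) \<noteq> (a \<in> odd_set W)) (eps * (e_list W * e_list W))"
      unfolding e_list_e_AC by (simp add: sgn_if_mult mult.assoc[symmetric] e_AC_square)
    finally have eq: "(e_list (a # W) * e_list (a # W) :: ('k, 'n, 's) alg_AC)
      = sgn_if (odd (card (odd_set W)) \<noteq> (a \<in> odd_set W)) (eps * (e_list W * e_list W))" .
    have eps: "(eps :: ('k, 'n, 's) alg_AC) \<in> {1, - 1}"
      using eps_cases[where 'k = 'k and 'n = 'n and 's = 's] by blast
    have closed: "a * b \<in> {1, - 1} \<and> sgn_if t a \<in> {1, - 1}" if "a \<in> {1, - 1}" "b \<in> {1, - 1}"
      for a b :: "('k, 'n, 's) alg_AC" and t
      using that by (auto simp: sgn_if_def)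
    show ?case
      unfolding eq using closed eps Cons by blast
  qed
  then show ?thesis using that by auto
qed

section \<open>Conjugation of vectors by Clifford products\<close>

text \<open>The part of \<open>D_op\<close> supported in \<open>S\<close>.\<close>

definition p_vec :: "'n set \<Rightarrow> ('k::real_or_complex, 'n::finite, 's::sign) alg_AC" where
  "p_vec S = (\<Sum>i\<in>S. e_AC i * p_AC i)"

lemma sum_mult_sum_swap:
  fixes f g :: "'i \<Rightarrow> 'a::ring"
  shows "sum g T * sum f S = (\<Sum>i\<in>S. \<Sum>j\<in>T. g j * f i)"
  unfolding sum_product by (subst sum.swap) (rule refl)

lemma anticommuting_sums:
  fixes f g :: "'i \<Rightarrow> 'a::ring"
  assumes "\<And>i j. i \<in> S \<Longrightarrow> j \<in> T \<Longrightarrow> f i * g j + g j * f i = 0"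
  shows "sum f S * sum g T + sum g T * sum f S = 0"
proof -
  have "sum f S * sum g T + sum g T * sum f S = (\<Sum>i\<in>S. \<Sum>j\<in>T. f i * g j + g j * f i)"
    unfolding sum_product[of f S g T] sum_mult_sum_swap[of g T f S] sum.distrib ..
  also have "\<dots> = 0"
    by (intro sum.neutral ballI assms)
  finally show ?thesis .
qed

lemma e_AC_anticomm_neg: "i \<noteq> j \<Longrightarrow> e_AC j * e_AC i = - (e_AC i * e_AC j)"
  using e_AC_anticomm[of j i] by (simp add: eq_neg_iff_add_eq_0)

lemma mult_middle_swap:
  fixes a b c d :: "'a::semigroup_mult"
  assumes "b * c = c * b"
  shows "(a * b) * (c * d) = (a * c) * (b * d)"
proof -
  have "(a * b) * (c * d) = a * (b * c) * d"
    by (simp only: mult.assoc)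
  then show ?thesis
    unfolding assms by (simp only: mult.assoc)
qed

lemma p_term_mult: "(e_AC i * p_AC i) * (e_AC j * p_AC j) = (e_AC i * e_AC j) * (p_AC i * p_AC j)"
  by (rule mult_middle_swap) (rule e_p_commute[symmetric])

lemma x_term_mult: "(x_AC i * e_AC i) * (x_AC j * e_AC j) = (e_AC i * e_AC j) * (x_AC i * x_AC j)"
  unfolding e_x_commute[symmetric] by (rule mult_middle_swap) (rule e_x_commute[symmetric])

lemma px_term_mult: "(e_AC i * p_AC i) * (x_AC j * e_AC j) = (e_AC i * e_AC j) * (p_AC i * x_AC j)"
  unfolding e_x_commute[symmetric] by (rule mult_middle_swap) (rule e_p_commute[symmetric])

lemma xp_term_mult: "(x_AC j * e_AC j) * (e_AC i * p_AC i) = (e_AC j * e_AC i) * (x_AC j * p_AC i)"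
  unfolding e_x_commute[symmetric] by (rule mult_middle_swap) (rule e_x_commute[symmetric])

text \<open>Everything reduces to single terms with distinct \<open>i\<close>, \<open>j\<close>.
  There the sign from swapping generators turns commuting coefficients into anticommuting vectors,
  and the symmetric commutators of \<open>p_AC i\<close> and \<open>x_AC j\<close> into an
  antisymmetric expression.\<close>

lemma odd_vectors_p_x:
  "odd_vectors (p_vec :: _ \<Rightarrow> ('k::real_or_complex, 'n::finite, 's::sign) alg_AC) x_vec"
proof
  fix S T :: "'n set"
  assume "disjnt S T"
  then have ne: "i \<noteq> j" if "i \<in> S" "j \<in> T" for i j
    using that by (auto simp: disjnt_def)
  show "p_vec (S \<union> T) = (p_vec S + p_vec T :: ('k, 'n, 's) alg_AC)"
    "x_vec (S \<union> T) = (x_vec S + x_vec T :: ('k, 'n, 's) alg_AC)"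
    using \<open>disjnt S T\<close> by (auto simp: p_vec_def x_vec_def disjnt_def sum.union_disjoint)
  show "p_vec S * p_vec T + p_vec T * p_vec S = (0 :: ('k, 'n, 's) alg_AC)"
    unfolding p_vec_def
  proof (rule anticommuting_sums)
    fix i j assume "i \<in> S" "j \<in> T"
    then show "e_AC i * p_AC i * (e_AC j * p_AC j) + e_AC j * p_AC j * (e_AC i * p_AC i)
        = (0 :: ('k, 'n, 's) alg_AC)"
      unfolding p_term_mult e_AC_anticomm_neg[OF ne[OF \<open>i \<in> S\<close> \<open>j \<in> T\<close>]]
      by (simp add: p_AC_commute)
  qed
  show "x_vec S * x_vec T + x_vec T * x_vec S = (0 :: ('k, 'n, 's) alg_AC)"
    unfolding x_vec_def
  proof (rule anticommuting_sums)
    fix i j assume "i \<in> S" "j \<in> T"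
    then show "x_AC i * e_AC i * (x_AC j * e_AC j) + x_AC j * e_AC j * (x_AC i * e_AC i)
        = (0 :: ('k, 'n, 's) alg_AC)"
      unfolding x_term_mult e_AC_anticomm_neg[OF ne[OF \<open>i \<in> S\<close> \<open>j \<in> T\<close>]]
      by (simp add: x_AC_commute)
  qed
  let ?f = "\<lambda>i. e_AC i * p_AC i :: ('k, 'n, 's) alg_AC" and ?g = "\<lambda>i. x_AC i * e_AC i :: ('k, 'n, 's) alg_AC"
  have "(p_vec S * x_vec T + x_vec T * p_vec S) + (p_vec T * x_vec S + x_vec S * p_vec T) =
     (\<Sum>i\<in>S. \<Sum>j\<in>T. (?f i * ?g j + ?g j * ?f i) + (?f j * ?g i + ?g i * ?f j))"
    unfolding p_vec_def x_vec_def sum_product[of ?f S ?g T] sum_mult_sum_swap[of ?g T ?f S]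
      sum_mult_sum_swap[of ?f T ?g S] sum_product[of ?g S ?f T] sum.distrib ..
  also have "\<dots> = 0"
  proof (intro sum.neutral ballI)
    fix i j assume "i \<in> S" "j \<in> T"
    have "(?f i * ?g j + ?g j * ?f i) + (?f j * ?g i + ?g i * ?f j)
      = (e_AC i * e_AC j) * ((p_AC i * x_AC j + x_AC i * p_AC j) - (p_AC j * x_AC i + x_AC j * p_AC i))"
      unfolding px_term_mult xp_term_mult e_AC_anticomm_neg[OF ne[OF \<open>i \<in> S\<close> \<open>j \<in> T\<close>]]
      by (simp add: algebra_simps)
    also have "\<dots> = 0"
      unfolding p_x_AC_symmetric[of i j] by simp
    finally show "(?f i * ?g j + ?g j * ?f i) + (?f j * ?g i + ?g i * ?f j) = 0" .
  qed
  finally show "(p_vec S * x_vec T + x_vec T * p_vec S) + (p_vec T * x_vec S + x_vec S * p_vec T)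
    = (0 :: ('k, 'n, 's) alg_AC)" .
qed

interpretation clifford: odd_vectors p_vec x_vec
  by (rule odd_vectors_p_x)

section \<open>Moving Clifford products past vectors\<close>

lemma e_list_p_AC:
  "(e_list W * p_AC i :: ('k::real_or_complex, 'n::finite, 's::sign) alg_AC) = p_AC i * e_list W"
proof (induction W)
  case (Cons a W)
  have "(e_list (a # W) * p_AC i :: ('k, 'n, 's) alg_AC) = e_AC a * p_AC i * e_list W"
    using Cons by (simp add: e_list_def mult.assoc)
  also have "\<dots> = p_AC i * e_list (a # W)"
    unfolding e_p_commute by (simp add: e_list_def mult.assoc)
  finally show ?case .
qed (simp add: e_list_def)

lemma e_list_x_AC:
  "(e_list W * x_AC i :: ('k::real_or_complex, 'n::finite, 's::sign) alg_AC) = x_AC i * e_list W"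
proof (induction W)
  case (Cons a W)
  have "(e_list (a # W) * x_AC i :: ('k, 'n, 's) alg_AC) = e_AC a * x_AC i * e_list W"
    using Cons by (simp add: e_list_def mult.assoc)
  also have "\<dots> = x_AC i * e_list (a # W)"
    unfolding e_x_commute by (simp add: e_list_def mult.assoc)
  finally show ?case .
qed (simp add: e_list_def)

text \<open>The terms inside and outside \<open>S\<close> pick up opposite signs; the sign of the
  former is taken out as the common one.\<close>

lemma twist_sum:
  fixes E :: "'a::ring"
  assumes "\<And>i. E * f i = sgn_if (b \<noteq> (i \<in> S)) (f i * E)" and "finite T"
  shows "E * sum f T = sgn_if (\<not> b) ((sum f (T \<inter> S) - sum f (T - S)) * E)"
proof -
  have "E * sum f T = E * sum f (T \<inter> S) + E * sum f (T - S)"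
    using assms(2) by (simp add: sum.Int_Diff[of T f S] distrib_left)
  also have "E * sum f (T \<inter> S) = sgn_if (\<not> b) (sum f (T \<inter> S) * E)"
    unfolding sum_distrib_left sum_distrib_right sgn_if_sum by (intro sum.cong refl) (simp add: assms)
  also have "E * sum f (T - S) = sgn_if b (sum f (T - S) * E)"
    unfolding sum_distrib_left sum_distrib_right sgn_if_sum by (intro sum.cong refl) (simp add: assms)
  finally show ?thesis by (auto simp: sgn_if_def algebra_simps)
qed

lemma e_list_p_vec:
  "e_list W * p_vec T = sgn_if (even (card (odd_set W)))
    ((p_vec (T \<inter> odd_set W) - p_vec (T - odd_set W)) * e_list W)"
proof -
  have "e_list W * (e_AC i * p_AC i)
     = sgn_if (odd (card (odd_set W)) \<noteq> (i \<in> odd_set W)) (e_AC i * p_AC i * e_list W)" for i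
    unfolding mult.assoc[symmetric] e_list_e_AC sgn_if_mult by (simp only: mult.assoc e_list_p_AC)
  from twist_sum[OF this, of T] show ?thesis
    by (simp add: p_vec_def)
qed

lemma e_list_x_vec:
  "e_list W * x_vec T = sgn_if (even (card (odd_set W)))
    ((x_vec (T \<inter> odd_set W) - x_vec (T - odd_set W)) * e_list W)"
proof -
  have "e_list W * (x_AC i * e_AC i)
     = sgn_if (odd (card (odd_set W)) \<noteq> (i \<in> odd_set W)) (x_AC i * e_AC i * e_list W)" for i
    unfolding mult.assoc[symmetric] e_list_x_AC
    by (simp only: mult.assoc e_list_e_AC sgn_if_mult)
  from twist_sum[OF this, of T] show ?thesis
    by (simp add: x_vec_def)
qed

text \<open>The common signs of the two vectors depend on the same parity and cancel; the relative
  signs inside and outside \<open>odd_set W\<close> remain.\<close>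

lemma e_list_p_x:
  "(e_list W * (p_vec T * x_vec U) :: ('k::real_or_complex, 'n::finite, 's::sign) alg_AC)
    = ((p_vec (T \<inter> odd_set W) - p_vec (T - odd_set W))
      * (x_vec (U \<inter> odd_set W) - x_vec (U - odd_set W))) * e_list W"
  (is "_ = (?a * ?b) * _")
proof -
  let ?e = "even (card (odd_set W))"
  have "(e_list W * (p_vec T * x_vec U) :: ('k, 'n, 's) alg_AC) = (e_list W * p_vec T) * x_vec U"
    by (simp only: mult.assoc)
  also have "\<dots> = sgn_if ?e (?a * (e_list W * x_vec U))"
    by (simp only: e_list_p_vec sgn_if_mult mult.assoc)
  also have "\<dots> = sgn_if ?e (sgn_if ?e ((?a * ?b) * e_list W))"
    by (simp only: e_list_x_vec sgn_if_mult mult.assoc)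
  finally show ?thesis
    by (simp add: sgn_if_def)
qed

lemma e_list_x_p:
  "(e_list W * (x_vec T * p_vec U) :: ('k::real_or_complex, 'n::finite, 's::sign) alg_AC)
    = ((x_vec (T \<inter> odd_set W) - x_vec (T - odd_set W))
      * (p_vec (U \<inter> odd_set W) - p_vec (U - odd_set W))) * e_list W"
  (is "_ = (?a * ?b) * _")
proof -
  let ?e = "even (card (odd_set W))"
  have "(e_list W * (x_vec T * p_vec U) :: ('k, 'n, 's) alg_AC) = (e_list W * x_vec T) * p_vec U"
    by (simp only: mult.assoc)
  also have "\<dots> = sgn_if ?e (?a * (e_list W * p_vec U))"
    by (simp only: e_list_x_vec sgn_if_mult mult.assoc)
  also have "\<dots> = sgn_if ?e (sgn_if ?e ((?a * ?b) * e_list W))"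
    by (simp only: e_list_p_vec sgn_if_mult mult.assoc)
  finally show ?thesis
    by (simp add: sgn_if_def)
qed

lemma e_list_twisted:
  "e_list W * clifford.twisted UNIV T = clifford.twisted (odd_set W) T * e_list W"
proof -
  have "(UNIV - T) \<inter> odd_set W = odd_set W - T" "UNIV - T - odd_set W = - odd_set W \<inter> - T"
    "UNIV - odd_set W = - odd_set W"
    by auto
  then show ?thesis
    by (simp add: clifford.twisted_def right_diff_distrib e_list_p_x e_list_x_p left_diff_distrib)
qed

lemma O_op_eq:
  assumes "\<And>A. A \<in> set As \<Longrightarrow> distinct A"
  shows "(O_op As :: ('k::real_or_complex, 'n::finite, 's::sign) alg_AC)
    = (1/2) *\<^sub>K ((clifford.twisted UNIV (odd_set (concat As)) - eps) * e_list (concat As))"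
proof -
  let ?W = "concat As"
  have index: "index_set As = odd_set ?W"
    by (rule index_set_eq_odd_set) (rule assms)
  have E: "prod_list (map e_list As) = (e_list ?W :: ('k, 'n, 's) alg_AC)"
    by (induction As) (simp_all add: e_list_def)
  have D: "(D_op :: ('k, 'n, 's) alg_AC) = p_vec UNIV"
    by (simp add: D_op_def p_vec_def)
  \<comment> \<open>The position vector is supported in the index set, so only the part of
    \<open>p_vec UNIV\<close> outside it changes its relative sign.\<close>
  have "(e_list ?W * x_vec (odd_set ?W) * p_vec UNIV :: ('k, 'n, 's) alg_AC)
    = x_vec (odd_set ?W) * (p_vec (odd_set ?W) - p_vec (UNIV - odd_set ?W)) * e_list ?W"
    unfolding mult.assoc e_list_x_p by (simp add: mult.assoc)
  then show ?thesis
    unfolding O_op_def Let_def E index D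
    by (simp add: clifford.twisted_def left_diff_distrib)
qed

text \<open>The expression q(S,T): \<open>twisted UNIV S\<close> plays the role of t_S, and
  \<open>twisted S T\<close> that of t_T conjugated by e_S.\<close>

definition quad :: "'n set \<Rightarrow> 'n set \<Rightarrow> ('k::real_or_complex, 'n::finite, 's::sign) alg_AC" where
  "quad S T = (clifford.twisted UNIV S - eps) * (clifford.twisted S T - eps)
    + (clifford.twisted UNIV T - eps) * (clifford.twisted T S - eps)"

text \<open>As \<open>eps\<close> is central, \<open>quad\<close> is \<open>pair_product\<close>
  minus \<open>eps\<close> times \<open>pair_sum\<close> plus twice the square of
  \<open>eps\<close>, and \<open>pair_identity\<close> treats the first two parts.\<close>

lemma quad_identity:
  fixes S T U :: "'n::finite set"
  assumes "disjnt S T" "disjnt S U" "disjnt T U"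
  shows "(quad (S \<union> U) (T \<union> U) :: ('k::real_or_complex, 'n, 's::sign) alg_AC)
    = quad S T + quad U (S \<union> T \<union> U)
      + eps * ((clifford.twisted UNIV (S \<union> T) - eps) + (clifford.twisted UNIV (S \<union> T) - eps))"
proof -
  have quad: "(quad A B :: ('k, 'n, 's) alg_AC) = clifford.pair_product A B - eps * clifford.pair_sum A B + (eps * eps + eps * eps)"
    for A B :: "'n set"
  proof -
    have "y * eps = eps * y" for y :: "('k, 'n, 's) alg_AC"
      by (rule eps_commute[symmetric])
    note this[of "clifford.twisted _ _"]
    then show ?thesis
      unfolding quad_def clifford.pair_product_def clifford.pair_sum_def by (simp add: left_diff_distrib right_diff_distrib distrib_left)
  qed
  have L: "clifford.pair_sum (S \<union> U) (T \<union> U) = (clifford.pair_sum S T + clifford.pair_sum U (S \<union> T \<union> U)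
      - (clifford.twisted UNIV (S \<union> T) + clifford.twisted UNIV (S \<union> T)) :: ('k, 'n, 's) alg_AC)"
    using clifford.pair_identity(2)[OF assms] by (simp add: eq_diff_eq)
  show ?thesis
    unfolding quad clifford.pair_identity(1)[OF assms] L by (simp add: algebra_simps)
qed

section \<open>The supercommutator\<close>

text \<open>The sign of the supercommutator undoes that of \<open>e_list_swap\<close>, so both
  products end in the same Clifford element; 1/4 comes from the two factors 1/2.\<close>

lemma supercomm_eq:
  assumes "\<And>A. A \<in> set As \<Longrightarrow> distinct A" and "\<And>B. B \<in> set Bs \<Longrightarrow> distinct B"
  shows "(supercomm_plus As Bs :: ('k::real_or_complex, 'n::finite, 's::sign) alg_AC)
    = (1/4) *\<^sub>K (quad (odd_set (concat As)) (odd_set (concat Bs)) * (e_list (concat As) * e_list (concat Bs)))"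
proof -
  define S T where "S = odd_set (concat As)" and "T = odd_set (concat Bs)"
  define EA EB :: "('k, 'n, 's) alg_AC" where "EA = e_list (concat As)" and "EB = e_list (concat Bs)"
  let ?t = "clifford.twisted :: _ \<Rightarrow> _ \<Rightarrow> ('k, 'n, 's) alg_AC"
  have index: "index_set As = S" "index_set Bs = T"
    unfolding S_def T_def using assms by (auto intro!: index_set_eq_odd_set)
  have O: "O_op As = (1/2) *\<^sub>K ((?t UNIV S - eps) * EA)" "O_op Bs = (1/2) *\<^sub>K ((?t UNIV T - eps) * EB)"
    unfolding S_def T_def EA_def EB_def using assms by (auto intro!: O_op_eq)
  have half: "((1/2) *\<^sub>K a) * ((1/2) *\<^sub>K b) = (1/4) *\<^sub>K (a * b)" for a b :: "('k, 'n, 's) alg_AC"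
    by (simp add: scale_mult_left scale_mult_right scale_scale)
  have twist: "EA * (?t UNIV T - eps) = (?t S T - eps) * EA" "EB * (?t UNIV S - eps) = (?t T S - eps) * EB"
    unfolding EA_def EB_def S_def T_def
    by (simp_all only: right_diff_distrib left_diff_distrib e_list_twisted eps_commute)
  have "EA * (?t UNIV T - eps) * EB = (?t S T - eps) * (EA * EB)"
    "EB * (?t UNIV S - eps) * EA = (?t T S - eps) * (EB * EA)"
    by (simp_all only: twist mult.assoc)
  then have prods: "O_op As * O_op Bs = (1/4) *\<^sub>K (((?t UNIV S - eps) * (?t S T - eps)) * (EA * EB))"
    "O_op Bs * O_op As = (1/4) *\<^sub>K (((?t UNIV T - eps) * (?t T S - eps)) * (EB * EA))"
    unfolding O half by (simp_all add: mult.assoc)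
  let ?n = "card S * card T - card (S \<inter> T)"
  \<comment> \<open>The diagonal embeds the intersection into the product set, so the subtraction of
    naturals is not truncated and parities may be computed termwise.\<close>
  have "card (S \<inter> T) \<le> card S * card T"
    using card_mono[of "S \<times> T" "(\<lambda>i. (i, i)) ` (S \<inter> T)"]
    by (auto simp: card_image inj_on_def card_cartesian_product)
  then have parity: "odd ?n \<longleftrightarrow> ((odd (card S) \<and> odd (card T)) \<noteq> odd (card (S \<inter> T)))"
    by (simp add: even_diff_nat) blast
  have "(- 1) ^ ?n * (EB * EA) = sgn_if (odd ?n) (EB * EA)"
    unfolding minus_one_power sgn_if_def by simp
  also have "\<dots> = EA * EB"
    unfolding parity unfolding EA_def EB_def S_def T_def by (rule e_list_swap[symmetric])
  finally have sign: "(- 1) ^ ?n * (EB * EA) = EA * EB" .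
  have comm: "(- 1) ^ ?n * (c *\<^sub>K (y * z)) = c *\<^sub>K (y * ((- 1) ^ ?n * z))"
    for c and y z :: "('k, 'n, 's) alg_AC"
    unfolding minus_one_power by (simp add: scale_minus)
  show ?thesis
    unfolding supercomm_plus_def Let_def index prods comm sign quad_def
    unfolding S_def[symmetric] T_def[symmetric] EA_def[symmetric] EB_def[symmetric]
    by (simp only: scale_add_right distrib_right)
qed

theorem theorem3p16:
  fixes A B :: "'n::finite list"
  assumes "distinct A" and "distinct B"
  shows "(supercomm_plus [A] [B] :: ('k::real_or_complex, 'n, 's::sign) alg_AC) =
    eps * O_op [A, B]
    + (e_list (list_inter A B))\<^sup>2 * supercomm_plus [A, list_inter A B] [list_inter A B, B]
    + (e_list (list_inter A B))\<^sup>2 * supercomm_plus [list_inter A B] [list_inter A B, A, B]"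
proof -
  define C where "C = list_inter A B"
  define S T U where "S = set A - set B" and "T = set B - set A" and "U = set A \<inter> set B"
  define a b c :: "('k, 'n, 's) alg_AC" where "a = e_list A" and "b = e_list B" and "c = e_list C"
  have C: "distinct C" "set C = U"
    using assms(1) by (auto simp: C_def U_def list_inter_def)
  have "disjnt S T" "disjnt S U" "disjnt T U"
    by (auto simp: S_def T_def U_def disjnt_def)
  note id = quad_identity[OF this]
  have sets: "set A = S \<union> U" "set B = T \<union> U"
    by (auto simp: S_def T_def U_def)
  have odd_sets: "odd_set A = S \<union> U" "odd_set B = T \<union> U" "odd_set C = U"
    using assms C sets by (simp_all add: odd_set_distinct)
  \<comment> \<open>Appending the common letters \<open>C\<close> cancels them from \<open>A\<close>
    and from \<open>B\<close>, but restores them in the symmetric difference of \<open>A\<close> and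
    \<open>B\<close>.\<close>
  have indices: "odd_set (A @ C) = S" "odd_set (C @ B) = T" "odd_set (A @ B) = S \<union> T"
    "odd_set (C @ A @ B) = S \<union> T \<union> U"
    unfolding odd_set_append odd_sets by (auto simp: S_def T_def U_def)
  have cc: "(c * c = 1) \<or> (c * c = - 1)"
    unfolding c_def by (rule e_list_square_cases) auto
  \<comment> \<open>As \<open>c * c\<close> is 1 or -1, the prefactor of the theorem cancels the
    copy of \<open>c * c\<close> produced by the Clifford products.\<close>
  have square: "c * c * ((1/4) *\<^sub>K (q * (c * c * z))) = (1/4) *\<^sub>K (q * z)" for q z
    using cc by (elim disjE) (simp_all add: scale_minus)
  have AB: "supercomm_plus [A] [B] = (1/4) *\<^sub>K (quad (S \<union> U) (T \<union> U) * (a * b))"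
    by (subst supercomm_eq) (use assms in \<open>simp_all add: odd_sets a_def b_def\<close>)
  have "(a * c) * (c * b) = a * (c * c) * b"
    by (simp only: mult.assoc)
  also have "\<dots> = c * c * (a * b)"
    using cc by (elim disjE) simp_all
  finally have acb: "(a * c) * (c * b) = c * c * (a * b)" .
  have "supercomm_plus [A, C] [C, B] = (1/4) *\<^sub>K (quad S T * ((a * c) * (c * b)))"
    by (subst supercomm_eq) (use assms C in \<open>auto simp: indices a_def b_def c_def e_list_append\<close>)
  then have AC: "c * c * supercomm_plus [A, C] [C, B] = (1/4) *\<^sub>K (quad S T * (a * b))"
    by (simp only: acb square)
  have "supercomm_plus [C] [C, A, B] = (1/4) *\<^sub>K (quad U (S \<union> T \<union> U) * (c * c * (a * b)))"
    by (subst supercomm_eq)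
      (use assms C in \<open>auto simp: indices odd_sets a_def b_def c_def e_list_append mult.assoc\<close>)
  then have CC: "c * c * supercomm_plus [C] [C, A, B] = (1/4) *\<^sub>K (quad U (S \<union> T \<union> U) * (a * b))"
    by (simp only: square)
  let ?t = "clifford.twisted UNIV (S \<union> T) - eps :: ('k, 'n, 's) alg_AC"
  \<comment> \<open>Brings the single operator to the factor 1/4 of the supercommutators, producing
    the doubled term of \<open>quad_identity\<close>.\<close>
  have quarter: "(1/2) *\<^sub>K z = (1/4) *\<^sub>K (z + z)" for z :: "('k, 'n, 's) alg_AC"
    using scale_add_left[of "1/4" "1/4" z] by (simp add: scale_add_right)
  have "O_op [A, B] = (1/2) *\<^sub>K (?t * (a * b))"
    by (subst O_op_eq) (use assms in \<open>auto simp: indices a_def b_def e_list_append\<close>)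
  then have "eps * O_op [A, B] = (1/4) *\<^sub>K (eps * (?t + ?t) * (a * b))"
    unfolding quarter by (simp add: scale_mult_right mult.assoc distrib_right)
  then show ?thesis
    unfolding C_def[symmetric] c_def[symmetric] power2_eq_square AB AC CC id
    by (simp add: scale_add_right[symmetric] distrib_right add_ac)
qed

end
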